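(* The Dedekind system $\mathcal D$ consists of exactly the following elements: (A) the circles with center $k/n$ on the real axis and radius $1/n$, for all integers $k$ and $n\ge 1$ satisfying one of the following conditions: (i) $n$ is odd and $n\mid (k^2-1)$; or (ii) $n$ is a multiple of $8$ and $(k^2-1)/n$ is an odd integer; (B) the vertical lines $\{z\in\mathbb C:\operatorname{Re} z=k/2\}$ for all odd integers $k$.
   Context: The group $\mathrm{PSL}(2,\mathbb Z)$ acts on the extended complex plane $\mathbb C\cup\{\infty\}$ by Möbius transformations $z\mapsto \frac{az+b}{cz+d}$ with $a,b,c,d\in\mathbb Z$, $ad-bc=1$. Let $\Delta=\{z\in\mathbb C: \operatorname{Im} z>0,\ |z|\ge 1,\ |\operatorname{Re} z|\le \tfrac12\}$ be the fundamental domain; its three sides lie on the unit circle $|z|=1$ and on the lines $\operatorname{Re} z=\pm\tfrac12$. The Dedekind tessellation is the family of ideal triangles $g\Delta$, $g\in \mathrm{PSL}(2,\mathbb Z)$. The Dedekind system $\mathcal D$ is the set of all (full) circles and straight lines in $\mathbb C$ that contain a side of some triangle $g\Delta$ (lines being regarded as circles through $\infty$, of curvature $0$). *)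

theory Defs
  imports "HOL-Analysis.Analysis"
begin

definition mobius :: "int \<Rightarrow> int \<Rightarrow> int \<Rightarrow> int \<Rightarrow> complex \<Rightarrow> complex" where
  "mobius a b c d z = (of_int a * z + of_int b) / (of_int c * z + of_int d)"

text \<open>The elements of PSL(2,Z) are taken as transformations, so a matrix and its negative
  give the same element. They are total functions on the finite plane, with the value 0 at
  a pole and without the point at infinity; below they are applied only to points of the open
  upper half-plane, where no pole occurs and where they keep the imaginary part positive.\<close>

definition PSL2Z :: "(complex \<Rightarrow> complex) set" where
  "PSL2Z = {mobius a b c d | a b c d. a * d - b * c = 1}"

lemma mobius_no_pole:
  assumes "a * d - b * c = 1" and "Im z > 0"
  shows "of_int c * z + of_int d \<noteq> 0"
proof
  assume eq: "of_int c * z + of_int d = 0"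
  then have "Im (of_int c * z + of_int d) = 0" by simp
  with assms(2) have c: "c = 0" by simp
  with eq have "d = 0" by simp
  with c assms(1) show False by simp
qed

definition fund_domain :: "complex set" where
  "fund_domain = {z. Im z > 0 \<and> norm z \<ge> 1 \<and> \<bar>Re z\<bar> \<le> 1 / 2}"

definition fund_sides :: "complex set set" where
  "fund_sides =
    {fund_domain \<inter> sphere 0 1,
     fund_domain \<inter> {z. Re z = 1 / 2},
     fund_domain \<inter> {z. Re z = - (1 / 2)}}"

definition dedekind_tessellation :: "complex set set" where
  "dedekind_tessellation = {g ` fund_domain | g. g \<in> PSL2Z}"

definition triangle_sides :: "complex set \<Rightarrow> complex set set" where
  "triangle_sides T = {g ` s | g s. g \<in> PSL2Z \<and> T = g ` fund_domain \<and> s \<in> fund_sides}"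

definition circles :: "complex set set" where
  "circles = {sphere c r | c r. r > 0}"

definition straight_lines :: "complex set set" where
  "straight_lines = {affine hull {p, q} | p q. p \<noteq> q}"

definition dedekind_system :: "complex set set" where
  "dedekind_system =
    {C \<in> circles \<union> straight_lines. \<exists>T \<in> dedekind_tessellation. \<exists>s \<in> triangle_sides T. s \<subseteq> C}"

end

theory Submission
  imports Defs
begin

text \<open>A circle or line is the zero set of \<open>\<alpha> |z|\<^sup>2 + \<beta> Re z + \<gamma> Im z + \<delta>\<close>, and a modular transformation
  acts on \<open>(\<alpha>, \<beta>, \<delta>)\<close> as on the binary quadratic form \<open>\<alpha> x\<^sup>2 + \<beta> x y + \<delta> y\<^sup>2\<close>, leaving \<open>\<gamma>\<close> alone. Each side
  of the fundamental domain determines its equation up to a factor, and the three equations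
  are forms \<open>n x\<^sup>2 - 2 k x y + m y\<^sup>2\<close> with \<open>k\<^sup>2 - n m = 1\<close> and \<open>n\<close>, \<open>m\<close> not both even, a condition
  preserved by the action. Conversely, such a form splits into integral linear factors; the
  transformation sending \<open>\<infinity>\<close> and \<open>1/2\<close> to the roots carries the side on \<open>Re z = 1/2\<close> to the
  given circle. For \<open>n\<close> even and \<open>m\<close> odd, \<open>k\<close> is odd and so \<open>8\<close> divides \<open>k\<^sup>2 - 1 = n m\<close>, hence \<open>n\<close>.\<close>

section \<open>The modular action on equations of circles and lines\<close>

definition gen_circle :: "real \<Rightarrow> real \<Rightarrow> real \<Rightarrow> real \<Rightarrow> complex set" where
  "gen_circle \<alpha> \<beta> \<gamma> \<delta> = {z. \<alpha> * (cmod z)\<^sup>2 + \<beta> * Re z + \<gamma> * Im z + \<delta> = 0}"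

text \<open>Write the image as u / w and multiply its equation by |w|^2. What remains involves
  |u|^2, Re (u cnj w) and |w|^2, which are combinations of |z|^2, Re z and 1, and Im (u cnj w),
  which equals Im z because the determinant is 1. Positivity of Im z excludes w = 0.\<close>

lemma mobius_in_gen_circle_iff:
  assumes det: "a * d - b * c = 1" and z: "Im z > 0"
  shows "mobius a b c d z \<in> gen_circle \<alpha> \<beta> \<gamma> \<delta> \<longleftrightarrow>
    z \<in> gen_circle (\<alpha> * a\<^sup>2 + \<beta> * a * c + \<delta> * c\<^sup>2)
      (2 * \<alpha> * a * b + \<beta> * (a * d + b * c) + 2 * \<delta> * c * d) \<gamma>
      (\<alpha> * b\<^sup>2 + \<beta> * b * d + \<delta> * d\<^sup>2)"
proof -
  define u where "u = of_int a * z + of_int b"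
  define w where "w = of_int c * z + of_int d"
  have w: "w \<noteq> 0"
    using mobius_no_pole[OF det z] by (simp add: w_def)
  have det': "real_of_int a * real_of_int d - real_of_int b * real_of_int c = 1"
    using arg_cong[OF det, of real_of_int] by simp
  have "mobius a b c d z = u / w"
    by (simp add: mobius_def u_def w_def)
  have norm: "(cmod w)\<^sup>2 * (cmod (u / w))\<^sup>2 = (cmod u)\<^sup>2"
    using w by (simp add: norm_divide power_divide)
  have quot: "u / w = (u * cnj w) / of_real ((cmod w)\<^sup>2)"
    using complex_div_cnj[of u w] by simp
  have re: "(cmod w)\<^sup>2 * Re (u / w) = Re (u * cnj w)"
    using w by (subst quot, subst Re_divide_of_real) simp
  have im: "(cmod w)\<^sup>2 * Im (u / w) = Im (u * cnj w)"
    using w by (subst quot, subst Im_divide_of_real) simp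
  have "Im (u * cnj w) =
      (real_of_int a * real_of_int d - real_of_int b * real_of_int c) * Im z"
    by (simp add: u_def w_def algebra_simps)
  then have im': "Im (u * cnj w) = Im z"
    by (simp add: det')
  have "(cmod w)\<^sup>2 * (\<alpha> * (cmod (u / w))\<^sup>2 + \<beta> * Re (u / w) + \<gamma> * Im (u / w) + \<delta>)
      = \<alpha> * ((cmod w)\<^sup>2 * (cmod (u / w))\<^sup>2) + \<beta> * ((cmod w)\<^sup>2 * Re (u / w))
        + \<gamma> * ((cmod w)\<^sup>2 * Im (u / w)) + \<delta> * (cmod w)\<^sup>2"
    by (simp only: algebra_simps)
  also have "\<dots> = \<alpha> * (cmod u)\<^sup>2 + \<beta> * Re (u * cnj w) + \<gamma> * Im z + \<delta> * (cmod w)\<^sup>2"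
    by (simp only: norm re im im')
  also have "\<dots> = (\<alpha> * a\<^sup>2 + \<beta> * a * c + \<delta> * c\<^sup>2) * (cmod z)\<^sup>2
      + (2 * \<alpha> * a * b + \<beta> * (a * d + b * c) + 2 * \<delta> * c * d) * Re z + \<gamma> * Im z
      + (\<alpha> * b\<^sup>2 + \<beta> * b * d + \<delta> * d\<^sup>2)"
    unfolding cmod_power2 u_def w_def by (simp add: power2_eq_square algebra_simps)
  finally show ?thesis
    using w \<open>mobius a b c d z = u / w\<close> by (auto simp: gen_circle_def)
qed

text \<open>The same action, now by the inverse matrix with rows (d, -b) and (-c, a): composing the
  two multiplies the form by the square of the determinant. It recovers the equation of a circle
  from that of its pullback.\<close>

lemma form_action_inverse:
  fixes a b c d :: int and \<alpha> \<beta> \<delta> :: real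
  assumes det: "a * d - b * c = 1"
    and act: "\<alpha>' = \<alpha> * a\<^sup>2 + \<beta> * a * c + \<delta> * c\<^sup>2"
      "\<beta>' = 2 * \<alpha> * a * b + \<beta> * (a * d + b * c) + 2 * \<delta> * c * d"
      "\<delta>' = \<alpha> * b\<^sup>2 + \<beta> * b * d + \<delta> * d\<^sup>2"
  shows "\<alpha> = \<alpha>' * d\<^sup>2 - \<beta>' * c * d + \<delta>' * c\<^sup>2"
    and "\<beta> = - 2 * \<alpha>' * b * d + \<beta>' * (a * d + b * c) - 2 * \<delta>' * a * c"
    and "\<delta> = \<alpha>' * b\<^sup>2 - \<beta>' * a * b + \<delta>' * a\<^sup>2"
proof -
  have "\<alpha>' * d\<^sup>2 - \<beta>' * c * d + \<delta>' * c\<^sup>2 = \<alpha> * (of_int (a * d - b * c))\<^sup>2"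
    unfolding act of_int_diff of_int_add of_int_mult of_int_power by algebra
  then show "\<alpha> = \<alpha>' * d\<^sup>2 - \<beta>' * c * d + \<delta>' * c\<^sup>2" by (simp only: det) simp
  have "- 2 * \<alpha>' * b * d + \<beta>' * (a * d + b * c) - 2 * \<delta>' * a * c
      = \<beta> * (of_int (a * d - b * c))\<^sup>2"
    unfolding act of_int_diff of_int_add of_int_mult of_int_power by algebra
  then show "\<beta> = - 2 * \<alpha>' * b * d + \<beta>' * (a * d + b * c) - 2 * \<delta>' * a * c"
    by (simp only: det) simp
  have "\<alpha>' * b\<^sup>2 - \<beta>' * a * b + \<delta>' * a\<^sup>2 = \<delta> * (of_int (a * d - b * c))\<^sup>2"
    unfolding act of_int_diff of_int_add of_int_mult of_int_power by algebra
  then show "\<delta> = \<alpha>' * b\<^sup>2 - \<beta>' * a * b + \<delta>' * a\<^sup>2" by (simp only: det) simp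
qed

section \<open>Circles, lines and sides of the fundamental domain as zero sets\<close>

lemma gen_circle_scale:
  assumes "t \<noteq> 0"
  shows "gen_circle (t * \<alpha>) (t * \<beta>) (t * \<gamma>) (t * \<delta>) = gen_circle \<alpha> \<beta> \<gamma> \<delta>"
proof -
  have "t * \<alpha> * x + t * \<beta> * y + t * \<gamma> * v + t * \<delta> = t * (\<alpha> * x + \<beta> * y + \<gamma> * v + \<delta>)" for x y v
    by (simp add: algebra_simps)
  then show ?thesis
    using assms by (simp add: gen_circle_def)
qed

lemma sphere_eq_gen_circle:
  assumes "r > 0"
  shows "sphere c r = gen_circle 1 (- 2 * Re c) (- 2 * Im c) ((cmod c)\<^sup>2 - r\<^sup>2)"
proof -
  have "dist c z = r \<longleftrightarrow> (cmod (c - z))\<^sup>2 = r\<^sup>2" for z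
    using assms by (simp add: dist_norm)
  then show ?thesis
    unfolding gen_circle_def sphere_def cmod_power2
    by (auto simp: power2_eq_square algebra_simps)
qed

lemma line_eq_gen_circle:
  assumes "p \<noteq> q"
  shows "affine hull {p, q} =
    gen_circle 0 (Im (q - p)) (- Re (q - p)) (Re (q - p) * Im p - Im (q - p) * Re p)"
    (is "_ = ?G")
proof (intro equalityI subsetI)
  fix z assume "z \<in> affine hull {p, q}"
  then obtain s t where "z = s *\<^sub>R p + t *\<^sub>R q" "s + t = 1"
    unfolding affine_hull_2 by auto
  then have "Re z = (1 - t) * Re p + t * Re q" "Im z = (1 - t) * Im p + t * Im q"
    by (auto simp: eq_diff_eq[symmetric])
  then have "Im (q - p) * Re z + - Re (q - p) * Im z + (Re (q - p) * Im p - Im (q - p) * Re p) = 0"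
    unfolding minus_complex.sel by algebra
  then show "z \<in> ?G" unfolding gen_circle_def mem_Collect_eq mult_zero_left add_0_left .
next
  fix z assume "z \<in> ?G"
  then have eq: "(Im z - Im p) * Re (q - p) = (Re z - Re p) * Im (q - p)"
    by (simp add: gen_circle_def algebra_simps)
  \<comment> \<open>The parameter is read off from a coordinate in which \<open>p\<close> and
    \<open>q\<close> differ; by \<open>eq\<close> it is then correct for the other coordinate
    too.\<close>
  define t where "t = (if Re (q - p) = 0 then (Im z - Im p) / Im (q - p)
    else (Re z - Re p) / Re (q - p))"
  have "Re (q - p) \<noteq> 0 \<or> Im (q - p) \<noteq> 0"
    using assms by (auto simp: complex_eq_iff)
  then have "Re z - Re p = t * Re (q - p)" "Im z - Im p = t * Im (q - p)"
    using eq by (auto simp: t_def field_simps)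
  then have "z = (1 - t) *\<^sub>R p + t *\<^sub>R q"
    by (auto simp: complex_eq_iff algebra_simps)
  then show "z \<in> affine hull {p, q}"
    unfolding affine_hull_2 by force
qed

text \<open>The nonvanishing condition matters later: it forces the factor between the equation of
  \<open>C\<close> and an integral form to be nonzero, so that it can be cancelled.\<close>

lemma circle_or_line_gen_circle:
  assumes "C \<in> circles \<union> straight_lines"
  obtains \<alpha> \<beta> \<gamma> \<delta> where "C = gen_circle \<alpha> \<beta> \<gamma> \<delta>" "\<alpha> \<noteq> 0 \<or> \<beta> \<noteq> 0 \<or> \<gamma> \<noteq> 0"
proof (cases "C \<in> circles")
  case True
  then obtain c r where "C = sphere c r" "r > 0" by (auto simp: circles_def)
  with sphere_eq_gen_circle[of r c] show ?thesis using that[of 1] by simp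
next
  case False
  then obtain p q where C: "C = affine hull {p, q}" "p \<noteq> q"
    using assms by (auto simp: straight_lines_def)
  then have "Im (q - p) \<noteq> 0 \<or> - Re (q - p) \<noteq> 0" by (auto simp: complex_eq_iff)
  then show ?thesis using that[OF trans[OF C(1) line_eq_gen_circle[OF C(2)]]] by blast
qed

lemma vertical_line_straight: "{z. Re z = x} \<in> straight_lines"
proof -
  have "affine hull {of_real x, Complex x 1} = {z. Re z = x}"
    by (subst line_eq_gen_circle) (auto simp: gen_circle_def complex_eq_iff)
  then show ?thesis
    unfolding straight_lines_def
    by (intro CollectI exI[of _ "of_real x"] exI[of _ "Complex x 1"]) (auto simp: complex_eq_iff)
qed

text \<open>Three points of a circle fix its equation up to a factor; here they are the midpoint i
  of the arc and its two corners. The corners differ only in the sign of Re z, which kills \<beta>;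
  their height differs from that of i, which kills \<gamma>.\<close>

lemma arc_side_determines:
  assumes "fund_domain \<inter> sphere 0 1 \<subseteq> gen_circle \<alpha> \<beta> \<gamma> \<delta>"
  shows "\<beta> = 0" "\<gamma> = 0" "\<delta> = - \<alpha>"
proof -
  have mem: "Complex x y \<in> fund_domain \<inter> sphere 0 1"
    if "x\<^sup>2 + y\<^sup>2 = 1" "y > 0" "\<bar>x\<bar> \<le> 1/2" for x y
    using that by (simp add: fund_domain_def complex_norm)
  have "Complex 0 1 \<in> gen_circle \<alpha> \<beta> \<gamma> \<delta>"
    using assms mem[of 0 1] by auto
  moreover have "Complex (1/2) (sqrt 3 / 2) \<in> gen_circle \<alpha> \<beta> \<gamma> \<delta>"
    by (rule subsetD[OF assms mem]) (auto simp: power_divide)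
  moreover have "Complex (-1/2) (sqrt 3 / 2) \<in> gen_circle \<alpha> \<beta> \<gamma> \<delta>"
    by (rule subsetD[OF assms mem]) (auto simp: power_divide)
  ultimately have *: "\<alpha> + \<gamma> + \<delta> = 0" "\<alpha> + \<beta> / 2 + \<gamma> * (sqrt 3 / 2) + \<delta> = 0"
    "\<alpha> - \<beta> / 2 + \<gamma> * (sqrt 3 / 2) + \<delta> = 0"
    by (auto simp: gen_circle_def cmod_power2 power_divide)
  from *(2,3) show "\<beta> = 0" by simp
  with * have "\<gamma> * (sqrt 3 / 2 - 1) = 0" unfolding right_diff_distrib by linarith
  moreover have "sqrt 3 \<noteq> 2" using real_sqrt_eq_iff[of 3 4] by simp
  ultimately show "\<gamma> = 0" by simp
  with *(1) show "\<delta> = - \<alpha>" by simp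
qed

text \<open>Along the side the equation is a polynomial in the height y of degree at most 2.
  Vanishing at the heights 1, 2 and 3, all in the domain, makes its coefficients zero: \<alpha> for
  y^2, then \<gamma> for y, and the constant term gives \<delta>.\<close>

lemma vertical_side_determines:
  assumes "fund_domain \<inter> {z. Re z = x} \<subseteq> gen_circle \<alpha> \<beta> \<gamma> \<delta>" "\<bar>x\<bar> = 1/2"
  shows "\<alpha> = 0" "\<gamma> = 0" "\<delta> = - x * \<beta>"
proof -
  have mem: "\<alpha> * (x\<^sup>2 + y\<^sup>2) + \<beta> * x + \<gamma> * y + \<delta> = 0" if "y \<ge> 1" for y
  proof -
    have "1 \<le> x\<^sup>2 + y\<^sup>2"
      using that one_le_power[of y 2] zero_le_power2[of x] by linarith
    then have "Complex x y \<in> fund_domain"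
      using that assms(2) by (simp add: fund_domain_def complex_norm)
    then have "Complex x y \<in> gen_circle \<alpha> \<beta> \<gamma> \<delta>" using assms(1) by auto
    then show ?thesis by (simp add: gen_circle_def cmod_power2)
  qed
  note m = mem[of 1] mem[of 2] mem[of 3]
  show "\<alpha> = 0" using m by (simp add: algebra_simps)
  with m show "\<gamma> = 0" "\<delta> = - x * \<beta>" by (auto simp: algebra_simps)
qed

section \<open>Members of the Dedekind system have integral equations\<close>

lemma dedekind_system_iff:
  "C \<in> dedekind_system \<longleftrightarrow> C \<in> circles \<union> straight_lines \<and>
    (\<exists>a b c d s. a * d - b * c = 1 \<and> s \<in> fund_sides \<and> mobius a b c d ` s \<subseteq> C)"
    (is "?L \<longleftrightarrow> ?C \<and> ?R")
proof
  assume "?L"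
  then obtain T s where C: ?C and "s \<in> triangle_sides T" "s \<subseteq> C"
    unfolding dedekind_system_def by blast
  then obtain g s' where "g \<in> PSL2Z" "s' \<in> fund_sides" "g ` s' \<subseteq> C"
    unfolding triangle_sides_def by blast
  moreover from \<open>g \<in> PSL2Z\<close> obtain a b c d where "g = mobius a b c d" "a * d - b * c = 1"
    unfolding PSL2Z_def by blast
  ultimately show "?C \<and> ?R" using C by blast
next
  assume "?C \<and> ?R"
  then obtain a b c d s where C: ?C and det: "a * d - b * c = 1"
    and s: "s \<in> fund_sides" "mobius a b c d ` s \<subseteq> C"
    by blast
  from det have g: "mobius a b c d \<in> PSL2Z" unfolding PSL2Z_def by blast
  then have "mobius a b c d ` fund_domain \<in> dedekind_tessellation"
    unfolding dedekind_tessellation_def by blast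
  moreover have "mobius a b c d ` s \<in> triangle_sides (mobius a b c d ` fund_domain)"
    using g s(1) unfolding triangle_sides_def by blast
  ultimately show ?L using C s(2) unfolding dedekind_system_def by blast
qed

text \<open>With middle coefficient -2k and n > 0, the centre is k / n and the squared radius is
  (k^2 - n m) / n^2, so k^2 - n m = 1 means radius 1 / n.\<close>

definition int_circle :: "int \<Rightarrow> int \<Rightarrow> int \<Rightarrow> complex set" where
  "int_circle n k m = gen_circle (of_int n) (- 2 * of_int k) 0 (of_int m)"

definition odd_form_circles :: "complex set set" where
  "odd_form_circles = {int_circle n k m | n k m. k\<^sup>2 - n * m = 1 \<and> (odd n \<or> odd m)}"

lemma dedekind_system_subset: "dedekind_system \<subseteq> odd_form_circles"
proof
  fix C assume "C \<in> dedekind_system"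
  then obtain a b c d s where C: "C \<in> circles \<union> straight_lines"
    and det: "a * d - b * c = 1" and s: "s \<in> fund_sides" "mobius a b c d ` s \<subseteq> C"
    unfolding dedekind_system_iff by blast
  obtain \<alpha> \<beta> \<gamma> \<delta> where Ceq: "C = gen_circle \<alpha> \<beta> \<gamma> \<delta>" and nz: "\<alpha> \<noteq> 0 \<or> \<beta> \<noteq> 0 \<or> \<gamma> \<noteq> 0"
    using circle_or_line_gen_circle[OF C] .
  define \<alpha>' where "\<alpha>' = \<alpha> * a\<^sup>2 + \<beta> * a * c + \<delta> * c\<^sup>2"
  define \<beta>' where "\<beta>' = 2 * \<alpha> * a * b + \<beta> * (a * d + b * c) + 2 * \<delta> * c * d"
  define \<delta>' where "\<delta>' = \<alpha> * b\<^sup>2 + \<beta> * b * d + \<delta> * d\<^sup>2"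
  have "Im z > 0" if "z \<in> s" for z
    using that s(1) by (auto simp: fund_sides_def fund_domain_def)
  then have sub: "s \<subseteq> gen_circle \<alpha>' \<beta>' \<gamma> \<delta>'"
    using s(2) mobius_in_gen_circle_iff[OF det] unfolding Ceq \<alpha>'_def \<beta>'_def \<delta>'_def by auto
  note inv = form_action_inverse[OF det \<alpha>'_def \<beta>'_def \<delta>'_def]
  have "odd (a * d - b * c)" by (simp add: det)
  \<comment> \<open>Modulo 2, the outer coefficients n and m below are c + d and a + b for the arc,
    and c and a for the vertical sides. An odd determinant keeps either pair from vanishing modulo
    2.\<close>
  then have par: "\<not> (even a \<and> even c)" "\<not> (even (a + b) \<and> even (c + d))"
    by auto
  have concl: "C \<in> odd_form_circles"
    if "\<gamma> = 0" "\<alpha> = t * of_int n" "\<beta> = t * (- 2 * of_int k)" "\<delta> = t * of_int m"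
      "k\<^sup>2 - n * m = 1" "odd n \<or> odd m" for t and n k m :: int
  proof -
    have "t \<noteq> 0" using nz that by auto
    with gen_circle_scale[OF this, of "of_int n" "- 2 * of_int k" 0 "of_int m"] that
    have "C = int_circle n k m" by (simp add: Ceq int_circle_def)
    with that show ?thesis unfolding odd_form_circles_def by force
  qed
  from s(1) consider "s = fund_domain \<inter> sphere 0 1"
    | "s = fund_domain \<inter> {z. Re z = 1 / 2}" | "s = fund_domain \<inter> {z. Re z = - (1 / 2)}"
    unfolding fund_sides_def by blast
  then show "C \<in> odd_form_circles"
  proof cases
    case 1
    note h = arc_side_determines[OF sub[unfolded 1]]
    show ?thesis
    proof (rule concl)
      show "\<gamma> = 0" by (fact h)
      show "\<alpha> = \<alpha>' * of_int (d\<^sup>2 - c\<^sup>2)" "\<beta> = \<alpha>' * (- 2 * of_int (b * d - a * c))"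
        "\<delta> = \<alpha>' * of_int (b\<^sup>2 - a\<^sup>2)"
        using inv by (simp_all add: h algebra_simps)
      \<comment> \<open>Invariance of the discriminant: the arc itself has n = 1, k = 0, m = -1, for
        which k^2 - n m = 1.\<close>
      have "(b * d - a * c)\<^sup>2 - (d\<^sup>2 - c\<^sup>2) * (b\<^sup>2 - a\<^sup>2) = (a * d - b * c)\<^sup>2" by algebra
      then show "(b * d - a * c)\<^sup>2 - (d\<^sup>2 - c\<^sup>2) * (b\<^sup>2 - a\<^sup>2) = 1" by (simp add: det)
      show "odd (d\<^sup>2 - c\<^sup>2) \<or> odd (b\<^sup>2 - a\<^sup>2)" using par(2) by auto
    qed
  next
    case 2
    have x: "\<bar>1 / 2 :: real\<bar> = 1 / 2" by simp
    note h = vertical_side_determines[OF sub[unfolded 2] x]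
    show ?thesis
    proof (rule concl)
      show "\<gamma> = 0" by (fact h)
      \<comment> \<open>The side on Re z = 1/2 has the equation -2 Re z + 1 = 0, that is n = 0, k =
        1, m = 1. Comparing the middle coefficients gives the factor -\<beta>' / 2. The left-hand
        side differs only in m = -1.\<close>
      show "\<alpha> = (- \<beta>' / 2) * of_int (2 * c * d + c\<^sup>2)"
        "\<beta> = (- \<beta>' / 2) * (- 2 * of_int (a * d + b * c + a * c))"
        "\<delta> = (- \<beta>' / 2) * of_int (2 * a * b + a\<^sup>2)"
        using inv by (simp_all add: h algebra_simps)
      have "(a * d + b * c + a * c)\<^sup>2 - (2 * c * d + c\<^sup>2) * (2 * a * b + a\<^sup>2) = (a * d - b * c)\<^sup>2"
        by algebra
      then show "(a * d + b * c + a * c)\<^sup>2 - (2 * c * d + c\<^sup>2) * (2 * a * b + a\<^sup>2) = 1"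
        by (simp add: det)
      show "odd (2 * c * d + c\<^sup>2) \<or> odd (2 * a * b + a\<^sup>2)" using par(1) by auto
    qed
  next
    case 3
    have x: "\<bar>- (1 / 2) :: real\<bar> = 1 / 2" by simp
    note h = vertical_side_determines[OF sub[unfolded 3] x]
    show ?thesis
    proof (rule concl)
      show "\<gamma> = 0" by (fact h)
      show "\<alpha> = (- \<beta>' / 2) * of_int (2 * c * d - c\<^sup>2)"
        "\<beta> = (- \<beta>' / 2) * (- 2 * of_int (a * d + b * c - a * c))"
        "\<delta> = (- \<beta>' / 2) * of_int (2 * a * b - a\<^sup>2)"
        using inv by (simp_all add: h algebra_simps)
      have "(a * d + b * c - a * c)\<^sup>2 - (2 * c * d - c\<^sup>2) * (2 * a * b - a\<^sup>2) = (a * d - b * c)\<^sup>2"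
        by algebra
      then show "(a * d + b * c - a * c)\<^sup>2 - (2 * c * d - c\<^sup>2) * (2 * a * b - a\<^sup>2) = 1"
        by (simp add: det)
      show "odd (2 * c * d - c\<^sup>2) \<or> odd (2 * a * b - a\<^sup>2)" using par(1) by auto
    qed
  qed
qed

section \<open>Splitting integral forms and moving a side onto a given circle\<close>

lemma four_number_factorization:
  fixes n m x y :: int
  assumes "x * y = n * m" "n \<noteq> 0"
  obtains a c u v where "n = c * v" "m = a * u" "x = a * v" "y = u * c"
proof -
  \<comment> \<open>After division by the gcd, \<open>x\<close> and \<open>n\<close> leave coprime
    cofactors \<open>a\<close> and \<open>c\<close> with a y = c m. Hence \<open>c\<close> divides
    \<open>y\<close>, and the quotient is the fourth factor \<open>u\<close>.\<close>
  define v where "v = gcd x n"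
  have v: "v \<noteq> 0" using assms(2) by (simp add: v_def)
  then obtain a c where x: "x = a * v" and n: "n = c * v" and cop: "coprime a c"
    using gcd_coprime_exists[of x n] unfolding v_def by blast
  have "v * (a * y) = v * (c * m)" using assms(1) unfolding x n by (simp only: ac_simps)
  with v have eq: "a * y = c * m" by simp
  then have "c dvd a * y" by simp
  with cop have "c dvd y" by (simp add: coprime_dvd_mult_right_iff coprime_commute)
  then obtain u where u: "y = u * c" by (metis dvdE mult.commute)
  have "c * m = c * (a * u)" using eq unfolding u by (simp only: ac_simps)
  with n assms(2) have "m = a * u" by simp
  with x n u show ?thesis using that by blast
qed

text \<open>Factoring (k + 1) (k - 1) = n m splits n x^2 - 2 k x y + m y^2 as (c x - a y) (v x - u
  y), with roots a / c and u / v and a v - u c = 2. If (u, v) = (a, c) + 2 (b, d), then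
  \<open>b\<close> and \<open>d\<close> complete a matrix of determinant 1 that sends infinity to a
  / c and 1/2 to u / v.\<close>

lemma odd_form_root_matrix:
  fixes n k m :: int
  assumes disc: "k\<^sup>2 - n * m = 1" and par: "odd n \<or> odd m" and n: "n \<noteq> 0"
  obtains a b c d where "a * d - b * c = 1" "n = c * (c + 2 * d)" "m = a * (a + 2 * b)"
    "k = a * d + b * c + a * c"
proof -
  have "(k + 1) * (k - 1) = n * m"
    using disc by (simp add: power2_eq_square algebra_simps)
  from four_number_factorization[OF this n]
  obtain a c u v where f: "n = c * v" "m = a * u" "k + 1 = a * v" "k - 1 = u * c" .
  have det: "a * v - u * c = 2" using f(3,4) by linarith
  then have "even (a * v - u * c)" by simp
  \<comment> \<open>An odd n = c v makes \<open>c\<close> and \<open>v\<close> odd, and then a v - u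
    c even gives a and u equal parity; an odd m = a u works symmetrically.\<close>
  then have "even (u - a)" "even (v - c)" using par f by auto
  then obtain b d where "u - a = 2 * b" "v - c = 2 * d" by (elim evenE)
  then have uv: "u = a + 2 * b" "v = c + 2 * d" by auto
  show ?thesis
  proof (rule that)
    show "a * d - b * c = 1" using det by (simp add: uv algebra_simps)
    show "n = c * (c + 2 * d)" "m = a * (a + 2 * b)" using f by (simp_all add: uv)
    show "k = a * d + b * c + a * c" using f(3,4) by (simp add: uv algebra_simps)
  qed
qed

lemma int_circle_contains_side:
  fixes n k m :: int
  assumes det: "a * d - b * c = 1" and "n = c * (c + 2 * d)" "m = a * (a + 2 * b)"
    "k = a * d + b * c + a * c"
  shows "mobius a b c d ` (fund_domain \<inter> {z. Re z = 1 / 2}) \<subseteq> int_circle n k m"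
proof (rule image_subsetI)
  fix z assume z: "z \<in> fund_domain \<inter> {z. Re z = 1 / 2}"
  then have "Im z > 0" "Re z = 1 / 2" by (auto simp: fund_domain_def)
  \<comment> \<open>These are the coefficients of the pulled-back equation, which is therefore -2 Re
    z + 1 = 0, the line of the side.\<close>
  have 1: "n * a\<^sup>2 - 2 * k * a * c + m * c\<^sup>2 = 0"
    unfolding assms(2-4) by algebra
  have 2: "2 * n * a * b - 2 * k * (a * d + b * c) + 2 * m * c * d = - 2"
    and 3: "n * b\<^sup>2 - 2 * k * b * d + m * d\<^sup>2 = 1"
    using det unfolding assms(2-4) by algebra+
  note real_eqs = 1[THEN arg_cong[where f = real_of_int]] 2[THEN arg_cong[where f = real_of_int]]
    3[THEN arg_cong[where f = real_of_int]]
  show "mobius a b c d z \<in> int_circle n k m"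
    unfolding int_circle_def mobius_in_gen_circle_iff[OF det \<open>Im z > 0\<close>]
    using real_eqs \<open>Re z = 1 / 2\<close> by (simp add: gen_circle_def)
qed

section \<open>From integral equations to explicit centres, radii and lines\<close>

lemma sphere_eq_int_circle:
  fixes n k m :: int
  assumes "k\<^sup>2 - n * m = 1" "n \<ge> 1"
  shows "sphere (complex_of_real (of_int k / of_int n)) (1 / of_int n) =
    int_circle n k m"
proof -
  have n: "real_of_int n > 0" using assms(2) by simp
  have "(of_int k)\<^sup>2 - real_of_int n * of_int m = 1"
    using arg_cong[OF assms(1), of real_of_int] by simp
  then have "(of_int k / real_of_int n)\<^sup>2 - (1 / of_int n)\<^sup>2 = of_int m / of_int n"
    using n by (simp add: field_simps power2_eq_square)
  then have "sphere (complex_of_real (of_int k / of_int n)) (1 / of_int n) =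
      gen_circle 1 (- 2 * (of_int k / of_int n)) 0 (of_int m / of_int n)"
    using n by (subst sphere_eq_gen_circle) (simp_all add: norm_divide power_divide)
  also have "\<dots> = gen_circle (of_int n * 1) (of_int n * (- 2 * (of_int k / of_int n)))
      (of_int n * 0) (of_int n * (of_int m / of_int n))"
    using n by (intro gen_circle_scale[symmetric]) simp
  finally show ?thesis using n by (simp add: int_circle_def)
qed

lemma eight_dvd_odd_square_diff:
  fixes k :: int
  assumes "odd k"
  shows "8 dvd k\<^sup>2 - 1"
proof -
  obtain j where "k = 2 * j + 1" using assms by (auto elim: oddE)
  then have "k\<^sup>2 - 1 = 4 * (j * (j + 1))" by (simp add: power2_eq_square algebra_simps)
  moreover have "2 dvd j * (j + 1)" by simp
  ultimately show ?thesis using mult_dvd_mono[of 4 4 2 "j * (j + 1)"] by simp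
qed

definition listed_spheres :: "complex set set" where
  "listed_spheres =
    {sphere (complex_of_real (real_of_int k / real_of_int n)) (1 / real_of_int n) | k n :: int.
        n \<ge> 1 \<and>
        ((odd n \<and> n dvd k\<^sup>2 - 1) \<or>
         (8 dvd n \<and> (\<exists>m :: int. odd m \<and> k\<^sup>2 - 1 = m * n)))}"

definition listed_lines :: "complex set set" where
  "listed_lines = {{z :: complex. Re z = real_of_int k / 2} | k :: int. odd k}"

lemma odd_form_circle_listed_sphere:
  fixes n k m :: int
  assumes disc: "k\<^sup>2 - n * m = 1" and par: "odd n \<or> odd m" and n: "n \<ge> 1"
  shows "int_circle n k m \<in> listed_spheres"
proof -
  have eq: "k\<^sup>2 - 1 = m * n" using disc by (simp add: algebra_simps)
  have "(odd n \<and> n dvd k\<^sup>2 - 1) \<or> (8 dvd n \<and> (\<exists>m :: int. odd m \<and> k\<^sup>2 - 1 = m * n))"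
  proof (cases "odd n")
    case True
    then show ?thesis by (simp add: eq)
  next
    case False
    with par have m: "odd m" by simp
    have "even (k\<^sup>2 - 1)" using False by (simp add: eq)
    then have "odd k" by simp
    from eight_dvd_odd_square_diff[OF this] have "8 dvd m * n" by (simp add: eq)
    \<comment> \<open>Writing 8 as a power of 2 reduces coprimality with \<open>m\<close> to
      \<open>m\<close> being odd.\<close>
    moreover have "coprime (2 ^ 3) m" using m by (simp del: power_numeral add: coprime_power_left_iff)
    then have "coprime 8 m" by simp
    ultimately have "8 dvd n" by (simp add: coprime_dvd_mult_right_iff)
    with m eq show ?thesis by blast
  qed
  with n sphere_eq_int_circle[OF disc n, symmetric] show ?thesis
    unfolding listed_spheres_def by blast
qed

lemma odd_form_circles_subset: "odd_form_circles \<subseteq> listed_spheres \<union> listed_lines"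
proof
  fix C assume "C \<in> odd_form_circles"
  then obtain n k m :: int where C: "C = int_circle n k m"
    and disc: "k\<^sup>2 - n * m = 1" and par: "odd n \<or> odd m"
    unfolding odd_form_circles_def by auto
  consider "n = 0" | "n \<ge> 1" | "- n \<ge> 1" by linarith
  then show "C \<in> listed_spheres \<union> listed_lines"
  proof cases
    case 1
    with disc have "k\<^sup>2 = 1" by simp
    then have k: "k * k = 1" "k = 1 \<or> k = - 1" by (auto simp: power2_eq_square square_eq_1_iff)
    \<comment> \<open>The equation is -2 k Re z + m = 0, and 1 / k = k because k is 1 or -1.\<close>
    have "C = {z. Re z = real_of_int (k * m) / 2}"
      using k(2) by (auto simp: C 1 int_circle_def gen_circle_def)
    moreover have "odd (k * m)" using par 1 k(2) by auto
    ultimately show ?thesis unfolding listed_lines_def by blast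
  next
    case 2
    with odd_form_circle_listed_sphere[OF disc par] C show ?thesis by simp
  next
    case 3
    \<comment> \<open>Negating the triple keeps the circle, k^2 - n m and all parities, and makes
      the leading coefficient positive.\<close>
    have "int_circle (- n) (- k) (- m) = C"
      using gen_circle_scale[of "- 1" "of_int n" "- 2 * of_int k" 0 "of_int m"]
      by (simp add: C int_circle_def)
    with odd_form_circle_listed_sphere[of "- k" "- n" "- m"] disc par 3 show ?thesis by simp
  qed
qed

section \<open>Every listed circle and line belongs to the system\<close>

lemma dedekind_systemI:
  fixes n k m :: int
  assumes "C \<in> circles \<union> straight_lines" "C = int_circle n k m"
    "a * d - b * c = 1" "n = c * (c + 2 * d)" "m = a * (a + 2 * b)" "k = a * d + b * c + a * c"
  shows "C \<in> dedekind_system"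
proof -
  have "fund_domain \<inter> {z. Re z = 1 / 2} \<in> fund_sides"
    by (simp add: fund_sides_def)
  moreover have "mobius a b c d ` (fund_domain \<inter> {z. Re z = 1 / 2}) \<subseteq> C"
    unfolding assms(2) by (rule int_circle_contains_side[OF assms(3-6)])
  ultimately show ?thesis
    using assms(1,3) unfolding dedekind_system_iff by blast
qed

lemma listed_spheres_subset: "listed_spheres \<subseteq> dedekind_system"
proof
  fix C assume "C \<in> listed_spheres"
  then obtain k n :: int where C: "C = sphere (complex_of_real (of_int k / of_int n)) (1 / of_int n)"
    and n: "n \<ge> 1"
    and cond: "(odd n \<and> n dvd k\<^sup>2 - 1) \<or> (8 dvd n \<and> (\<exists>m :: int. odd m \<and> k\<^sup>2 - 1 = m * n))"
    unfolding listed_spheres_def by blast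
  \<comment> \<open>The cofactor \<open>m\<close> is (k^2 - 1) / n; condition (i) makes
    \<open>n\<close> odd and condition (ii) makes \<open>m\<close> odd.\<close>
  from cond obtain m where "k\<^sup>2 - 1 = n * m" "odd n \<or> odd m"
    by (metis dvdE mult.commute)
  then have disc: "k\<^sup>2 - n * m = 1" and par: "odd n \<or> odd m" by auto
  have "n \<noteq> 0" using n by simp
  from odd_form_root_matrix[OF disc par this] obtain a b c d where
    "a * d - b * c = 1" "n = c * (c + 2 * d)" "m = a * (a + 2 * b)" "k = a * d + b * c + a * c" .
  moreover have "C \<in> circles \<union> straight_lines"
    using n unfolding C circles_def by force
  ultimately show "C \<in> dedekind_system"
    using dedekind_systemI C sphere_eq_int_circle[OF disc n] by metis
qed

lemma listed_lines_subset: "listed_lines \<subseteq> dedekind_system"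
proof
  fix C assume "C \<in> listed_lines"
  then obtain k :: int where C: "C = {z. Re z = of_int k / 2}" and "odd k"
    unfolding listed_lines_def by blast
  then obtain b where b: "k = 2 * b + 1" by (auto elim: oddE)
  show "C \<in> dedekind_system"
  \<comment> \<open>The matrix is the translation by \<open>b\<close>, which carries Re z = 1/2 to
    Re z = 1/2 + b = k / 2; the line has the equation -2 Re z + k = 0.\<close>
  proof (rule dedekind_systemI[where n = 0 and k = 1 and m = k and a = 1 and b = b and c = 0 and d = 1])
    show "C \<in> circles \<union> straight_lines"
      using vertical_line_straight unfolding C by blast
    show "C = int_circle 0 1 k"
      by (auto simp: C int_circle_def gen_circle_def)
  qed (simp_all add: b)
qed

theorem theorem3p7:
  "dedekind_system =
     {sphere (complex_of_real (real_of_int k / real_of_int n)) (1 / real_of_int n) | k n :: int.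
        n \<ge> 1 \<and>
        ((odd n \<and> n dvd k\<^sup>2 - 1) \<or>
         (8 dvd n \<and> (\<exists>m :: int. odd m \<and> k\<^sup>2 - 1 = m * n)))}
   \<union> {{z :: complex. Re z = real_of_int k / 2} | k :: int. odd k}"
  unfolding listed_spheres_def[symmetric] listed_lines_def[symmetric]
proof (rule equalityI)
  show "dedekind_system \<subseteq> listed_spheres \<union> listed_lines"
    using dedekind_system_subset odd_form_circles_subset by (rule subset_trans)
  show "listed_spheres \<union> listed_lines \<subseteq> dedekind_system"
    using listed_spheres_subset listed_lines_subset by (rule Un_least)
qed

end
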